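(* Let $n\ge 1$, let $\Pi:\mathbb{R}^n\to\mathbb{R}$ be a polynomial function, let $c>0$ and let $r>\sqrt{n}$. For every $\varepsilon>0$ the penalized problem $$\min_{V\in \overline{B}(0;r)} J_\varepsilon(V)$$ has a solution $U_\varepsilon\in\overline{B}(0;r)$. Moreover, from any family $\{U_\varepsilon\}_{\varepsilon>0}$ of such solutions (with $\varepsilon$ decreasing to $0$) one can extract a subsequence, i.e. there is a sequence $\varepsilon_k>0$ decreasing to $0$ such that $U_{\varepsilon_k}$ converges to a point $U$, where $U$ is a solution of the problem $$\min_{V\in\{\pm1\}^n}\left[\frac{c}{2}\|V\|_2^2+\Pi(V)\right],$$ that is, $U\in\{\pm 1\}^n$ is a global minimizer of $\Pi$ over $\{\pm1\}^n$.
   Context: For $\varepsilon>0$, the functional $J_\varepsilon:\mathbb{R}^n\to\mathbb{R}$ is $$J_\varepsilon(V)=\frac{1}{4\varepsilon}\|V\circ V-\mathbf{1}\|_2^2+\frac{c}{2}\|V\|_2^2+\Pi(V),$$ where $V\circ V=(v_i^2)_{i=1}^n$ is the Hadamard (componentwise) product, $\mathbf{1}=(1,\dots,1)\in\mathbb{R}^n$, and $\|\cdot\|_2$ is the Euclidean norm. $\overline{B}(0;r)$ denotes the closed Euclidean ball of radius $r$ centered at the origin of $\mathbb{R}^n$. *)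

theory Defs
  imports "HOL-Analysis.Analysis"
begin

(* On real ^ 'n both the product V * V and the vector 1 are componentwise in HOL-Analysis. *)
definition penalized ::
  "(real ^ 'n \<Rightarrow> real) \<Rightarrow> real \<Rightarrow> real \<Rightarrow> real ^ 'n \<Rightarrow> real" where
  "penalized P c \<epsilon> V =
     1 / (4 * \<epsilon>) * (norm (V * V - 1))\<^sup>2 + c / 2 * (norm V)\<^sup>2 + P V"

definition sign_vectors :: "(real ^ 'n) set" where
  "sign_vectors = {V. \<forall>i. V $ i \<in> {1, -1}}"

end

theory Submission
  imports Defs
begin

text \<open>
  This is the classical convergence argument for the penalty method. Write the penalized functional
  as \<open>G V / (4 * \<epsilon>) + F V\<close> with \<open>G V = \<parallel>V * V - 1\<parallel>\<^sup>2\<close> and \<open>F V = c / 2 * \<parallel>V\<parallel>\<^sup>2 + P V\<close>. Both are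
  continuous, so minimizers on the compact ball exist, and any family of them has a cluster point
  as \<open>\<epsilon>\<close> tends to \<open>0\<close>.

  The zeros of the nonnegative function \<open>G\<close> are exactly the sign vectors. They have norm \<open>sqrt n\<close>
  and so lie in the ball, which makes each of them a competitor at zero penalty. Comparing a
  penalized minimizer \<open>U\<close> with such a competitor \<open>W\<close> gives \<open>G U / (4 * \<epsilon>) + F U \<le> F W\<close>. Two
  conclusions follow in the limit: \<open>F\<close> at the cluster point is at most \<open>F W\<close>, and, since \<open>F\<close> is
  bounded along the sequence, \<open>G\<close> vanishes at the cluster point
  (\<open>penalty_limit_is_constrained_minimizer\<close>). Finally, the norm is constant on sign vectors, so
  there \<open>F\<close> and \<open>P\<close> have the same minimizers.
\<close>

lemma real_polynomial_function_continuous_on: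
  fixes P :: "'a::euclidean_space \<Rightarrow> real"
  assumes "real_polynomial_function P"
  shows "continuous_on S P"
  using assms continuous_on_polymonial_function real_polynomial_function_eq by blast

lemma compact_imp_arg_min_exists:
  fixes f :: "'a::topological_space \<Rightarrow> real"
  assumes "compact K" "K \<noteq> {}" "continuous_on K f"
  shows "\<exists>x. is_arg_min f (\<lambda>x. x \<in> K) x"
  using continuous_attains_inf[OF assms] by (force simp: is_arg_min_linorder)

text \<open>
  The subsequence of penalty weights can be taken inside any sequence decreasing to \<open>0\<close>;
  \<open>1 / (k + 1)\<close> is used.
\<close>

lemma decreasing_subfamily_converges:
  fixes u :: "real \<Rightarrow> 'a::metric_space"
  assumes "compact K" and "\<And>\<epsilon>. \<epsilon> > 0 \<Longrightarrow> u \<epsilon> \<in> K"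
  obtains \<epsilon> :: "nat \<Rightarrow> real" and l where "\<And>k. \<epsilon> k > 0" "\<And>k. \<epsilon> (Suc k) < \<epsilon> k" "\<epsilon> \<longlonglongrightarrow> 0"
    "l \<in> K" "(\<lambda>k. u (\<epsilon> k)) \<longlonglongrightarrow> l"
proof -
  define \<delta> :: "nat \<Rightarrow> real" where "\<delta> k = inverse (real (Suc k))" for k
  have "\<forall>k. u (\<delta> k) \<in> K" using assms(2) by (simp add: \<delta>_def)
  then obtain l s where l: "l \<in> K" and s: "strict_mono s" and lim: "((\<lambda>k. u (\<delta> k)) \<circ> s) \<longlonglongrightarrow> l"
    using \<open>compact K\<close> unfolding compact_def by metis
  show thesis
  proof
    show "\<delta> (s k) > 0" for k by (simp add: \<delta>_def)
    show "\<delta> (s (Suc k)) < \<delta> (s k)" for k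
      using s unfolding \<delta>_def strict_mono_Suc_iff by (intro less_imp_inverse_less) auto
    have "\<delta> \<longlonglongrightarrow> 0" unfolding \<delta>_def by (rule LIMSEQ_inverse_real_of_nat)
    then show "(\<lambda>k. \<delta> (s k)) \<longlonglongrightarrow> 0"
      using LIMSEQ_subseq_LIMSEQ[OF _ s] by (simp add: o_def)
    show "(\<lambda>k. u (\<delta> (s k))) \<longlonglongrightarrow> l" using lim by (simp add: o_def)
  qed (fact l)
qed

text \<open>
  A feasible point \<open>w\<close> pays no penalty, so optimality of \<open>u k\<close> bounds \<open>F (u k)\<close> by \<open>F w\<close> and
  \<open>G (u k)\<close> by \<open>4 * \<epsilon> k * (F w - F (u k))\<close>, and the latter bound tends to \<open>0\<close>. Feasibility of the
  limit thus rests on at least one feasible point being available for comparison.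
\<close>

lemma penalty_limit_is_constrained_minimizer:
  fixes F G :: "'a::topological_space \<Rightarrow> real"
  assumes "continuous_on K F" "continuous_on K G"
    and G_nonneg: "\<And>x. G x \<ge> 0"
    and feasible: "\<exists>w\<in>K. G w = 0"
    and \<epsilon>_pos: "\<And>k::nat. \<epsilon> k > 0" and \<epsilon>_lim: "\<epsilon> \<longlonglongrightarrow> 0"
    and min: "\<And>k. is_arg_min (\<lambda>x. 1 / (4 * \<epsilon> k) * G x + F x) (\<lambda>x. x \<in> K) (u k)"
    and u_lim: "u \<longlonglongrightarrow> l" and "l \<in> K"
  shows "is_arg_min F (\<lambda>x. x \<in> K \<and> G x = 0) l"
proof -
  have u_in: "u k \<in> K" for k using min[of k] by (simp add: is_arg_min_linorder)
  have F_lim: "(\<lambda>k. F (u k)) \<longlonglongrightarrow> F l" and G_lim: "(\<lambda>k. G (u k)) \<longlonglongrightarrow> G l"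
    using assms(1,2) u_lim \<open>l \<in> K\<close> u_in by (auto intro: continuous_on_tendsto_compose)
  have comparison: "1 / (4 * \<epsilon> k) * G (u k) + F (u k) \<le> F w" if "w \<in> K" "G w = 0" for w k
    using min[of k] that by (auto simp: is_arg_min_linorder dest: bspec[of _ _ w])
  have F_le: "F l \<le> F w" if "w \<in> K" "G w = 0" for w
  proof (rule LIMSEQ_le_const2[OF F_lim])
    have "F (u k) \<le> F w" for k
      using comparison[OF that, of k] G_nonneg[of "u k"] \<epsilon>_pos[of k]
      by (smt (verit) divide_nonneg_pos mult_nonneg_nonneg)
    then show "\<exists>N. \<forall>k\<ge>N. F (u k) \<le> F w" by blast
  qed
  obtain w where w: "w \<in> K" "G w = 0" using feasible by blast
  have "G l \<le> 0"
  proof (rule LIMSEQ_le[OF G_lim])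
    have "(\<lambda>k. 4 * \<epsilon> k * (F w - F (u k))) \<longlonglongrightarrow> 4 * 0 * (F w - F l)"
      by (intro tendsto_intros \<epsilon>_lim F_lim)
    then show "(\<lambda>k. 4 * \<epsilon> k * (F w - F (u k))) \<longlonglongrightarrow> 0" by simp
    have "G (u k) \<le> 4 * \<epsilon> k * (F w - F (u k))" for k
      using comparison[OF w, of k] \<epsilon>_pos[of k] by (simp add: field_simps)
    then show "\<exists>N. \<forall>k\<ge>N. G (u k) \<le> 4 * \<epsilon> k * (F w - F (u k))" by blast
  qed
  then have "G l = 0" using G_nonneg[of l] by simp
  then show ?thesis using F_le \<open>l \<in> K\<close> by (auto simp: is_arg_min_linorder)
qed

lemma sign_vectors_iff_penalty_zero:
  "V \<in> sign_vectors \<longleftrightarrow> (norm (V * V - 1))\<^sup>2 = 0"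
  by (simp add: sign_vectors_def vec_eq_iff square_eq_1_iff)

lemma norm_sign_vector:
  fixes V :: "real ^ 'n"
  assumes "V \<in> sign_vectors"
  shows "norm V = sqrt (real CARD('n))"
proof -
  have "(V $ i)\<^sup>2 = 1" for i
    using assms by (auto simp: sign_vectors_def power2_eq_1_iff)
  then show ?thesis by (simp add: norm_vec_def L2_set_def)
qed

theorem theorem1:
  fixes P :: "real ^ 'n \<Rightarrow> real" and c r :: real
  assumes "real_polynomial_function P"
    and "c > 0"
    and "r > sqrt (real CARD('n))"
  shows "(\<forall>\<epsilon>>0. \<exists>U. is_arg_min (penalized P c \<epsilon>) (\<lambda>V. V \<in> cball 0 r) U)
    \<and> (\<forall>U :: real \<Rightarrow> real ^ 'n.
         (\<forall>\<epsilon>>0. is_arg_min (penalized P c \<epsilon>) (\<lambda>V. V \<in> cball 0 r) (U \<epsilon>)) \<longrightarrow>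
         (\<exists>(\<epsilon> :: nat \<Rightarrow> real) U\<^sub>0.
            (\<forall>k. \<epsilon> k > 0) \<and> (\<forall>k. \<epsilon> (Suc k) < \<epsilon> k) \<and> \<epsilon> \<longlonglongrightarrow> 0
            \<and> (\<lambda>k. U (\<epsilon> k)) \<longlonglongrightarrow> U\<^sub>0
            \<and> is_arg_min (\<lambda>V. c / 2 * (norm V)\<^sup>2 + P V) (\<lambda>V. V \<in> sign_vectors) U\<^sub>0
            \<and> is_arg_min P (\<lambda>V. V \<in> sign_vectors) U\<^sub>0))"
proof (intro conjI allI impI)
  let ?K = "cball 0 r :: (real ^ 'n) set"
  define F where "F V = c / 2 * (norm V)\<^sup>2 + P V" for V
  define G where "G V = (norm (V * V - 1))\<^sup>2" for V :: "real ^ 'n"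
  have penalized_eq: "penalized P c \<epsilon> = (\<lambda>V. 1 / (4 * \<epsilon>) * G V + F V)" for \<epsilon>
    by (auto simp: penalized_def F_def G_def)
  have contF: "continuous_on ?K F" unfolding F_def
    by (intro continuous_intros real_polynomial_function_continuous_on assms)
  have contG: "continuous_on ?K G" unfolding G_def times_vec_def
    by (intro continuous_intros)
  have sign_vectors_in_ball: "V \<in> ?K" if "V \<in> sign_vectors" for V
    using norm_sign_vector[OF that] assms(3) by simp
  have feasible_iff: "V \<in> ?K \<and> G V = 0 \<longleftrightarrow> V \<in> sign_vectors" for V
    using sign_vectors_in_ball sign_vectors_iff_penalty_zero unfolding G_def by blast
  have one_sign: "(1 :: real ^ 'n) \<in> sign_vectors" by (simp add: sign_vectors_def)

  show "\<exists>U. is_arg_min (penalized P c \<epsilon>) (\<lambda>V. V \<in> ?K) U" for \<epsilon>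
  proof (rule compact_imp_arg_min_exists)
    show "?K \<noteq> {}" using sign_vectors_in_ball[OF one_sign] by blast
    show "continuous_on ?K (penalized P c \<epsilon>)"
      unfolding penalized_eq by (intro continuous_intros contF contG)
  qed simp

  fix U :: "real \<Rightarrow> real ^ 'n"
  assume min: "\<forall>\<epsilon>>0. is_arg_min (penalized P c \<epsilon>) (\<lambda>V. V \<in> ?K) (U \<epsilon>)"
  then have "U \<epsilon> \<in> ?K" if "\<epsilon> > 0" for \<epsilon>
    using that by (simp add: is_arg_min_def)
  then obtain \<epsilon> :: "nat \<Rightarrow> real" and U0 where \<epsilon>: "\<And>k. \<epsilon> k > 0" "\<And>k. \<epsilon> (Suc k) < \<epsilon> k" "\<epsilon> \<longlonglongrightarrow> 0"
    and U0: "U0 \<in> ?K" "(\<lambda>k. U (\<epsilon> k)) \<longlonglongrightarrow> U0"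
    using decreasing_subfamily_converges[of ?K U] compact_cball by blast
  have "is_arg_min F (\<lambda>V. V \<in> ?K \<and> G V = 0) U0"
  proof (rule penalty_limit_is_constrained_minimizer[OF contF contG])
    show "\<exists>W\<in>?K. G W = 0" using one_sign feasible_iff by blast
    show "is_arg_min (\<lambda>V. 1 / (4 * \<epsilon> k) * G V + F V) (\<lambda>V. V \<in> ?K) (U (\<epsilon> k))" for k
      using min \<epsilon>(1) unfolding penalized_eq by blast
  qed (use \<epsilon> U0 in \<open>auto simp: G_def\<close>)
  then have minF: "is_arg_min F (\<lambda>V. V \<in> sign_vectors) U0"
    by (simp only: feasible_iff)
  then have minP: "is_arg_min P (\<lambda>V. V \<in> sign_vectors) U0"
    by (auto simp: is_arg_min_linorder F_def norm_sign_vector)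
  show "\<exists>(\<epsilon> :: nat \<Rightarrow> real) U\<^sub>0.
            (\<forall>k. \<epsilon> k > 0) \<and> (\<forall>k. \<epsilon> (Suc k) < \<epsilon> k) \<and> \<epsilon> \<longlonglongrightarrow> 0
            \<and> (\<lambda>k. U (\<epsilon> k)) \<longlonglongrightarrow> U\<^sub>0
            \<and> is_arg_min (\<lambda>V. c / 2 * (norm V)\<^sup>2 + P V) (\<lambda>V. V \<in> sign_vectors) U\<^sub>0
            \<and> is_arg_min P (\<lambda>V. V \<in> sign_vectors) U\<^sub>0"
    using \<epsilon> U0(2) minF minP unfolding F_def by blast
qed

end
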